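(* Let $\alpha$ be a set with an involution $\tau$. The function $w\mapsto\|w\|_{br}$ on nanowords over $\alpha$ induces a conjugation invariant $\mathbb Z$-valued norm on the group $\mathcal N_c=\mathcal N_c(\alpha,\tau)$ of cobordism classes of nanowords.
   Context: **Norms.** A $\mathbb Z$-valued norm on a group $G$ is a map $f:G\to\{0,1,2,\dots\}$ with $f^{-1}(0)=\{1\}$, $f(g)=f(g^{-1})$ and $f(gg')\le f(g)+f(g')$ for all $g,g'\in G$. It is conjugation invariant if $f(h^{-1}gh)=f(g)$ for all $g,h\in G$. **Nanowords.** $\alpha$ is a set with an involution $\tau:\alpha\to\alpha$ ($\tau^2=\mathrm{id}$; fixed points allowed). An $\alpha$-alphabet is a set $\mathcal A$ with a map $\mathcal A\to\alpha$, $A\mapsto|A|$. A nanoword of length $n$ over $\alpha$ is a pair $(\mathcal A,w)$ with $\mathcal A$ an $\alpha$-alphabet and $w:\{1,\dots,n\}\to\mathcal A$ a map (written $w(1)\cdots w(n)$) taking every value in $\mathcal A$ exactly twice; $\emptyset$ is the empty nanoword. Nanowords $(\mathcal A,w),(\mathcal A',w')$ are isomorphic if $w'=fw$ for a bijection $f:\mathcal A\to\mathcal A'$ with $|f(A)|=|A|$. The opposite word is $w^-=w(n)\cdots w(1)$. The product of nanowords is concatenation, after making the alphabets disjoint. **Homotopy moves.** (1) $(\mathcal A,xAAy)\mapsto(\mathcal A-\{A\},xy)$; (2) $(\mathcal A,xAByBAz)\mapsto(\mathcal A-\{A,B\},xyz)$ if $|B|=\tau(|A|)$; (3) $(\mathcal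 A,xAByACzBCt)\mapsto(\mathcal A,xBAyCAzCBt)$ for distinct $A,B,C$ with $|A|=|B|=|C|$. **Surgery and cobordism.** A nanophrase $\nabla=(\mathcal B,(v_1|\cdots|v_k))$ is a sequence of words in an $\alpha$-alphabet $\mathcal B$ such that every letter of $\mathcal B$ appears exactly twice in $v_1\cdots v_k$. Put $\varepsilon_\nabla(B)=0$ if both occurrences of $B$ are in the same $v_r$, and $1$ otherwise. $\nabla$ is even if all $v_r$ have even length; it is symmetric if there is a bijection $\iota:\mathcal B\to\mathcal B$ with $\iota v_r=v_r^-$ for all $r$ and $|\iota(B)|=\tau^{\varepsilon_\nabla(B)}(|B|)$ for all $B$. $\nabla$ is a factor of $(\mathcal A,w)$ if $\mathcal B\subset\mathcal A$ (with restricted projection) and $w=x_1v_1x_2v_2\cdots x_kv_kx_{k+1}$ with $x_i$ words in $\mathcal A-\mathcal B$. A surgery replaces $(\mathcal A,w)$ by $(\mathcal A-\mathcal B,x_1\cdots x_{k+1})$, $\nabla$ being an even symmetric factor. Nanowords are cobordant if related by a finite sequence of isomorphisms, homotopy moves, surgeries and inverse moves. The cobordism classes form a group $\mathcal N_c(\alpha,\tau)$ under concatenation, with unit the class of $\emptyset$ and inverse of $w$ given by $w^-$. **Bridge moves.** A quasi-bridge in a nanoword $w$ is a pair $(\nabla,\kappa)$ with $\nabla=(\mathcal B,(v_1|\cdots|v_k))$ a factor of $w$, $k\ge1$, and $\kappa$ an involutive permutation of $\{1,\dots,k\}$ such that (a) $v_r$ has even length whenever $\kappa(r)=r$; (b)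 there is a map $\iota:\mathcal B\to\mathcal B$ with $\iota v_r=v_{\kappa(r)}^-$ for all $r$. The occurrence of $B\in\mathcal B$ in position $j$ of $v_r$ is symmetric to the occurrence of $\iota(B)$ in position $n_r+1-j$ of $v_{\kappa(r)}$, where $n_r$ is the length of $v_r$. Put $\varepsilon(B)=1$ if the occurrence symmetric to the leftmost occurrence of $B$ in $w$ is the leftmost occurrence of $\iota(B)$ in $w$, and $\varepsilon(B)=0$ otherwise. A quasi-bridge is a bridge if $|\iota(B)|=\tau^{\varepsilon(B)}(|B|)$ for all $B\in\mathcal B$. The corresponding bridge move $m$ transforms $(\mathcal A,w=x_1v_1\cdots x_kv_kx_{k+1})$ into $(\mathcal A-\mathcal B,x_1x_2\cdots x_{k+1})$; its number of arches $g(m)=g(m^{-1})$ is the number of 2-element orbits of $\kappa$. (A bridge move is always considered together with the bridge defining it.) **Bridge norm.** A metamorphosis $m:v\to w$ is a finite sequence $m=(m_1,\dots,m_n)$ of isomorphisms, homotopy moves, bridge moves, and inverses of such moves, transforming $v$ into $w$; $g(m)=\sum_ig(m_i)$ where $g(m_i)$ is the number of arches if $m_i$ is a bridge move or the inverse of one, and $g(m_i)=0$ otherwise. $\|w\|_{br}=\min_mg(m)$ over all metamorphoses $m:w\to\emptyset$. *)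

theory Defs
  imports "HOL-Algebra.Group"
begin

section \<open>Nanowords\<close>

text \<open>
  Letters are taken from the infinite supply \<open>nat\<close>; every nanoword has a finite alphabet, hence is
  isomorphic to one with letters in \<open>nat\<close>. The alphabet of a nanoword \<open>(p, w)\<close> is forced to be
  \<open>set w\<close>, so it is not stored. Only the values of the projection \<open>p\<close> on \<open>set w\<close> matter: nanowords
  that differ only in the other values of \<open>p\<close> are isomorphic. Correspondingly the moves below keep
  \<open>p\<close> fixed; for an inverse move one first uses such an isomorphism to give the new letters the
  wanted projections.
\<close>

type_synonym 'a nanoword = "(nat \<Rightarrow> 'a) \<times> nat list"

definition double_occurrence :: "nat list \<Rightarrow> bool" where
  "double_occurrence w \<longleftrightarrow> (\<forall>A\<in>set w. count_list w A = 2)"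

definition nanowords :: "'a set \<Rightarrow> 'a nanoword set" where
  "nanowords \<alpha> = {(p, w). double_occurrence w \<and> p ` set w \<subseteq> \<alpha>}"

definition empty_nanoword :: "'a nanoword" where
  "empty_nanoword = ((\<lambda>_. undefined), [])"

definition isomorphic :: "'a nanoword \<Rightarrow> 'a nanoword \<Rightarrow> bool" where
  "isomorphic v w \<longleftrightarrow>
     (\<exists>f. bij_betw f (set (snd v)) (set (snd w)) \<and> snd w = map f (snd v) \<and>
          (\<forall>A\<in>set (snd v). fst w (f A) = fst v A))"

text \<open>Concatenation after renaming the letters to even and odd ones, respectively.\<close>

definition nanoword_prod :: "'a nanoword \<Rightarrow> 'a nanoword \<Rightarrow> 'a nanoword" where
  "nanoword_prod v w =
     ((\<lambda>i. if even i then fst v (i div 2) else fst w (i div 2)),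
      map (\<lambda>i. 2 * i) (snd v) @ map (\<lambda>i. 2 * i + 1) (snd w))"


section \<open>Homotopy moves and surgeries\<close>

inductive homotopy_move :: "('a \<Rightarrow> 'a) \<Rightarrow> (nat \<Rightarrow> 'a) \<Rightarrow> nat list \<Rightarrow> nat list \<Rightarrow> bool"
  for \<tau> :: "'a \<Rightarrow> 'a" and p :: "nat \<Rightarrow> 'a" where
  move1: "homotopy_move \<tau> p (x @ [A, A] @ y) (x @ y)"
| move2: "p B = \<tau> (p A) \<Longrightarrow> homotopy_move \<tau> p (x @ [A, B] @ y @ [B, A] @ z) (x @ y @ z)"
| move3: "distinct [A, B, C] \<Longrightarrow> p A = p B \<Longrightarrow> p B = p C \<Longrightarrow>
    homotopy_move \<tau> p (x @ [A, B] @ y @ [A, C] @ z @ [B, C] @ t)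
                      (x @ [B, A] @ y @ [C, A] @ z @ [C, B] @ t)"

text \<open>
  A nanophrase is given by its list of words \<open>vs\<close>; its alphabet is \<open>set (concat vs)\<close>.
  \<open>factor_removal vs w w'\<close>: \<open>vs\<close> is a factor of \<open>w\<close> and \<open>w'\<close> is what remains of \<open>w\<close> after
  deleting it. In the equations \<open>xs\<close> lists the first \<open>k\<close> of the complementary words, \<open>z\<close> is the last one.
\<close>

definition nanophrase :: "nat list list \<Rightarrow> bool" where
  "nanophrase vs \<longleftrightarrow> double_occurrence (concat vs)"

definition factor_removal :: "nat list list \<Rightarrow> nat list \<Rightarrow> nat list \<Rightarrow> bool" where
  "factor_removal vs w w' \<longleftrightarrow> nanophrase vs \<and>
     (\<exists>xs z. length xs = length vs \<and> w = concat (map2 (@) xs vs) @ z \<and> w' = concat xs @ z \<and>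
             set w' \<inter> set (concat vs) = {})"

definition phrase_eps :: "nat list list \<Rightarrow> nat \<Rightarrow> nat" where
  "phrase_eps vs B = (if \<exists>r<length vs. count_list (vs ! r) B = 2 then 0 else 1)"

definition even_phrase :: "nat list list \<Rightarrow> bool" where
  "even_phrase vs \<longleftrightarrow> (\<forall>r<length vs. even (length (vs ! r)))"

definition symmetric_phrase :: "('a \<Rightarrow> 'a) \<Rightarrow> (nat \<Rightarrow> 'a) \<Rightarrow> nat list list \<Rightarrow> bool" where
  "symmetric_phrase \<tau> p vs \<longleftrightarrow>
     (\<exists>\<iota>. bij_betw \<iota> (set (concat vs)) (set (concat vs)) \<and>
          (\<forall>r<length vs. map \<iota> (vs ! r) = rev (vs ! r)) \<and>
          (\<forall>B\<in>set (concat vs). p (\<iota> B) = (\<tau> ^^ phrase_eps vs B) (p B)))"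

definition surgery :: "('a \<Rightarrow> 'a) \<Rightarrow> (nat \<Rightarrow> 'a) \<Rightarrow> nat list \<Rightarrow> nat list \<Rightarrow> bool" where
  "surgery \<tau> p w w' \<longleftrightarrow>
     (\<exists>vs. factor_removal vs w w' \<and> even_phrase vs \<and> symmetric_phrase \<tau> p vs)"


section \<open>Cobordism and the group of cobordism classes\<close>

definition cobordism_step :: "'a set \<Rightarrow> ('a \<Rightarrow> 'a) \<Rightarrow> ('a nanoword \<times> 'a nanoword) set" where
  "cobordism_step \<alpha> \<tau> = {(v, w). v \<in> nanowords \<alpha> \<and> w \<in> nanowords \<alpha> \<and>
     (isomorphic v w \<or>
      fst v = fst w \<and> (homotopy_move \<tau> (fst v) (snd v) (snd w) \<or> surgery \<tau> (fst v) (snd v) (snd w)))}"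

definition cobordism :: "'a set \<Rightarrow> ('a \<Rightarrow> 'a) \<Rightarrow> ('a nanoword \<times> 'a nanoword) set" where
  "cobordism \<alpha> \<tau> = (cobordism_step \<alpha> \<tau> \<union> (cobordism_step \<alpha> \<tau>)\<inverse>)\<^sup>* \<inter> (nanowords \<alpha> \<times> nanowords \<alpha>)"

definition cobordism_class :: "'a set \<Rightarrow> ('a \<Rightarrow> 'a) \<Rightarrow> 'a nanoword \<Rightarrow> 'a nanoword set" where
  "cobordism_class \<alpha> \<tau> w = cobordism \<alpha> \<tau> `` {w}"

definition cobordism_group :: "'a set \<Rightarrow> ('a \<Rightarrow> 'a) \<Rightarrow> 'a nanoword set monoid" where
  "cobordism_group \<alpha> \<tau> =
     \<lparr>carrier = nanowords \<alpha> // cobordism \<alpha> \<tau>,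
      mult = (\<lambda>X Y. \<Union>v\<in>X. \<Union>w\<in>Y. cobordism_class \<alpha> \<tau> (nanoword_prod v w)),
      one = cobordism_class \<alpha> \<tau> empty_nanoword\<rparr>"


section \<open>Bridge moves\<close>

text \<open>Positions are counted from 0: words \<open>0, \<dots>, k - 1\<close>, letters \<open>0, \<dots>, n - 1\<close> in a word of length \<open>n\<close>.\<close>

definition quasi_bridge :: "nat list list \<Rightarrow> (nat \<Rightarrow> nat) \<Rightarrow> (nat \<Rightarrow> nat) \<Rightarrow> bool" where
  "quasi_bridge vs \<kappa> \<iota> \<longleftrightarrow>
     1 \<le> length vs \<and>
     (\<forall>r<length vs. \<kappa> r < length vs \<and> \<kappa> (\<kappa> r) = r) \<and>
     (\<forall>r<length vs. \<kappa> r = r \<longrightarrow> even (length (vs ! r))) \<and>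
     \<iota> ` set (concat vs) \<subseteq> set (concat vs) \<and>
     (\<forall>r<length vs. map \<iota> (vs ! r) = rev (vs ! \<kappa> r))"

text \<open>
  \<open>leftmost vs B r j\<close>: position \<open>j\<close> of the word \<open>vs ! r\<close> carries the leftmost occurrence of \<open>B\<close>. As
  all occurrences of \<open>B\<close> in the ambient nanoword lie in the factor, and in the same order, it is also
  the leftmost occurrence there.
\<close>

definition leftmost :: "nat list list \<Rightarrow> nat \<Rightarrow> nat \<Rightarrow> nat \<Rightarrow> bool" where
  "leftmost vs B r j \<longleftrightarrow>
     r < length vs \<and> j < length (vs ! r) \<and> vs ! r ! j = B \<and>
     (\<forall>r' j'. r' < length vs \<and> j' < length (vs ! r') \<and> vs ! r' ! j' = B \<longrightarrow>
              r < r' \<or> r = r' \<and> j \<le> j')"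

definition bridge_eps :: "nat list list \<Rightarrow> (nat \<Rightarrow> nat) \<Rightarrow> (nat \<Rightarrow> nat) \<Rightarrow> nat \<Rightarrow> nat" where
  "bridge_eps vs \<kappa> \<iota> B =
     (if \<exists>r j. leftmost vs B r j \<and> leftmost vs (\<iota> B) (\<kappa> r) (length (vs ! r) - 1 - j) then 1 else 0)"

definition bridge :: "('a \<Rightarrow> 'a) \<Rightarrow> (nat \<Rightarrow> 'a) \<Rightarrow> nat list list \<Rightarrow> (nat \<Rightarrow> nat) \<Rightarrow> bool" where
  "bridge \<tau> p vs \<kappa> \<longleftrightarrow>
     (\<exists>\<iota>. quasi_bridge vs \<kappa> \<iota> \<and>
          (\<forall>B\<in>set (concat vs). p (\<iota> B) = (\<tau> ^^ bridge_eps vs \<kappa> \<iota> B) (p B)))"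

definition arches :: "nat list list \<Rightarrow> (nat \<Rightarrow> nat) \<Rightarrow> nat" where
  "arches vs \<kappa> = card {{r, \<kappa> r} | r. r < length vs \<and> \<kappa> r \<noteq> r}"

definition bridge_move :: "('a \<Rightarrow> 'a) \<Rightarrow> (nat \<Rightarrow> 'a) \<Rightarrow> nat \<Rightarrow> nat list \<Rightarrow> nat list \<Rightarrow> bool" where
  "bridge_move \<tau> p g w w' \<longleftrightarrow>
     (\<exists>vs \<kappa>. factor_removal vs w w' \<and> bridge \<tau> p vs \<kappa> \<and> g = arches vs \<kappa>)"


section \<open>Metamorphoses and the bridge norm\<close>

text \<open>\<open>elementary_move \<alpha> \<tau> g v w\<close>: some move, not inverted, transforms \<open>v\<close> into \<open>w\<close> and counts \<open>g\<close> arches.\<close>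

definition elementary_move :: "'a set \<Rightarrow> ('a \<Rightarrow> 'a) \<Rightarrow> nat \<Rightarrow> 'a nanoword \<Rightarrow> 'a nanoword \<Rightarrow> bool" where
  "elementary_move \<alpha> \<tau> g v w \<longleftrightarrow> v \<in> nanowords \<alpha> \<and> w \<in> nanowords \<alpha> \<and>
     (g = 0 \<and> isomorphic v w \<or>
      g = 0 \<and> fst v = fst w \<and> homotopy_move \<tau> (fst v) (snd v) (snd w) \<or>
      fst v = fst w \<and> bridge_move \<tau> (fst v) g (snd v) (snd w))"

inductive metamorphosis :: "'a set \<Rightarrow> ('a \<Rightarrow> 'a) \<Rightarrow> nat \<Rightarrow> 'a nanoword \<Rightarrow> 'a nanoword \<Rightarrow> bool"
  for \<alpha> :: "'a set" and \<tau> :: "'a \<Rightarrow> 'a" where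
  refl: "v \<in> nanowords \<alpha> \<Longrightarrow> metamorphosis \<alpha> \<tau> 0 v v"
| step: "elementary_move \<alpha> \<tau> g u v \<or> elementary_move \<alpha> \<tau> g v u \<Longrightarrow>
    metamorphosis \<alpha> \<tau> n v w \<Longrightarrow> metamorphosis \<alpha> \<tau> (g + n) u w"

definition bridge_norm :: "'a set \<Rightarrow> ('a \<Rightarrow> 'a) \<Rightarrow> 'a nanoword \<Rightarrow> nat" where
  "bridge_norm \<alpha> \<tau> w = (LEAST n. metamorphosis \<alpha> \<tau> n w empty_nanoword)"


text \<open>
  The minimum is over a nonempty set: a letter \<open>A\<close> of \<open>w = x A y A z\<close> can be removed by the bridge
  \<open>(A | A)\<close> with one arch.
\<close>

lemma bridge_move_letter:
  assumes "double_occurrence (x @ [A] @ y @ [A] @ z)"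
  shows "bridge_move \<tau> p 1 (x @ [A] @ y @ [A] @ z) (x @ y @ z)"
proof -
  let ?vs = "[[A], [A]]" and ?\<kappa> = "\<lambda>r::nat. 1 - r"
  have A: "A \<notin> set (x @ y @ z)"
    using assms by (auto simp: double_occurrence_def count_list_0_iff)
  have fr: "factor_removal ?vs (x @ [A] @ y @ [A] @ z) (x @ y @ z)"
    unfolding factor_removal_def
  proof (intro conjI exI[of _ "[x, y]"] exI[of _ z])
    show "nanophrase ?vs" by (simp add: nanophrase_def double_occurrence_def)
  qed (use A in auto)
  have lm: "r = 0" if "leftmost ?vs A r j" for r j
    using that unfolding leftmost_def by (metis length_Cons length_greater_0_conv list.distinct(1)
        nat.distinct(1) not_less_zero nth_Cons_0 zero_less_Suc neq0_conv)
  have eps: "bridge_eps ?vs ?\<kappa> (\<lambda>x. x) A = 0"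
    unfolding bridge_eps_def by (metis lm diff_zero zero_neq_one)
  have qb: "quasi_bridge ?vs ?\<kappa> (\<lambda>x. x)"
    by (auto simp: quasi_bridge_def less_Suc_eq)
  have br: "bridge \<tau> p ?vs ?\<kappa>"
    unfolding bridge_def by (rule exI[of _ "\<lambda>x. x"]) (use qb eps in auto)
  have "{{r, ?\<kappa> r} | r. r < length ?vs \<and> ?\<kappa> r \<noteq> r} = {{0, 1}}"
    by (auto simp: less_Suc_eq)
  then have "arches ?vs ?\<kappa> = 1" by (simp add: arches_def)
  with fr br show ?thesis unfolding bridge_move_def by metis
qed

lemma metamorphosis_to_empty:
  "w \<in> nanowords \<alpha> \<Longrightarrow> \<exists>n. metamorphosis \<alpha> \<tau> n w empty_nanoword"
proof (induction "length (snd w)" arbitrary: w rule: less_induct)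
  case less
  obtain p u where w: "w = (p, u)" by fastforce
  have e: "empty_nanoword \<in> nanowords \<alpha>"
    by (simp add: empty_nanoword_def nanowords_def double_occurrence_def)
  show ?case
  proof (cases u)
    case Nil
    then have "elementary_move \<alpha> \<tau> 0 w empty_nanoword"
      using less.prems e w
      by (auto simp: elementary_move_def isomorphic_def empty_nanoword_def bij_betw_def)
    then show ?thesis using metamorphosis.step metamorphosis.refl[OF e] by blast
  next
    case (Cons A v)
    have d: "double_occurrence u" using less.prems w by (simp add: nanowords_def)
    then have "A \<in> set v"
      using Cons by (auto simp: double_occurrence_def count_list_0_iff intro: ccontr)
    then obtain y z where "v = y @ A # z" by (meson split_list)
    then have u: "u = [] @ [A] @ y @ [A] @ z" using Cons by simp
    have bm: "bridge_move \<tau> p 1 u (y @ z)"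
      using bridge_move_letter[of "[]" A y z] d u by simp
    have A: "A \<notin> set (y @ z)"
      using d u by (auto simp: double_occurrence_def count_list_0_iff)
    have "count_list (y @ z) B = 2" if "B \<in> set (y @ z)" for B
    proof -
      have "count_list u B = 2" and "B \<noteq> A" using d u A that by (auto simp: double_occurrence_def)
      then show ?thesis by (simp add: u)
    qed
    then have n: "(p, y @ z) \<in> nanowords \<alpha>"
      using less.prems w u by (auto simp: nanowords_def double_occurrence_def)
    obtain n where "metamorphosis \<alpha> \<tau> n (p, y @ z) empty_nanoword"
      using less.hyps[of "(p, y @ z)"] n w u by auto
    moreover have "elementary_move \<alpha> \<tau> 1 w (p, y @ z)"
      using n less.prems bm w by (simp add: elementary_move_def)
    ultimately show ?thesis using metamorphosis.step by blast
  qed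
qed

lemma bridge_norm_attained:
  "w \<in> nanowords \<alpha> \<Longrightarrow> metamorphosis \<alpha> \<tau> (bridge_norm \<alpha> \<tau> w) w empty_nanoword"
  unfolding bridge_norm_def using metamorphosis_to_empty by (metis LeastI)


section \<open>Conjugation invariant norms\<close>

text \<open>Values in \<open>nat\<close>; the values of \<open>f\<close> outside the carrier are irrelevant.\<close>

definition conj_invariant_norm :: "('b, 'c) monoid_scheme \<Rightarrow> ('b \<Rightarrow> nat) \<Rightarrow> bool" where
  "conj_invariant_norm G f \<longleftrightarrow> group G \<and>
     (\<forall>g\<in>carrier G. f g = 0 \<longleftrightarrow> g = \<one>\<^bsub>G\<^esub>) \<and>
     (\<forall>g\<in>carrier G. f (inv\<^bsub>G\<^esub> g) = f g) \<and>
     (\<forall>g\<in>carrier G. \<forall>g'\<in>carrier G. f (g \<otimes>\<^bsub>G\<^esub> g') \<le> f g + f g') \<and>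
     (\<forall>g\<in>carrier G. \<forall>h\<in>carrier G. f (inv\<^bsub>G\<^esub> h \<otimes>\<^bsub>G\<^esub> g \<otimes>\<^bsub>G\<^esub> h) = f g)"

end

theory Submission
  imports Defs
begin

text \<open>
  A surgery is a bridge move without arches (\<open>\<kappa>\<close> the identity), and conversely, so that two nanowords
  are cobordant iff a metamorphosis with \<open>0\<close> arches joins them. Every move on a factor of a product is
  a move on the product with the same number of arches. Hence a metamorphosis \<open>g \<rightarrow> \<emptyset>\<close> can be
  multiplied from both sides, and the axioms of a conjugation invariant norm follow formally.
\<close>

text \<open>Surgeries and arch-free bridge moves differ in three places, and this is where the
  comparison takes work. A surgery may remove a phrase without words, a bridge has at least one
  word; removing nothing is matched by the identity isomorphism. A surgery asks for a bijection
  \<iota>, a bridge for a mere map; if \<kappa> fixes every word, this map is onto a finite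
  alphabet. Finally the exponents of \<tau> follow different rules: one asks whether both
  occurrences of a letter share a word, the other whether leftmost occurrences correspond.
  Reflecting each word in itself makes the two rules agree. Products code the letters of the two
  factors as even and odd numbers. Associativity and unit laws are therefore witnessed by recodings,
  which are isomorphisms and cost no arches, and a move on a factor becomes a move on an injectively
  renamed subword whose context uses letters of the other parity.\<close>

lemma isomorphicI:
  assumes "inj_on f (set (snd v))" and "snd w = map f (snd v)"
    and "\<And>A. A \<in> set (snd v) \<Longrightarrow> fst w (f A) = fst v A"
  shows "isomorphic v w"
  using assms unfolding isomorphic_def bij_betw_def by (intro exI[of _ f]) auto

lemma isomorphicE:
  assumes "isomorphic v w"
  obtains f where "inj_on f (set (snd v))" and "snd w = map f (snd v)"
    and "\<forall>A\<in>set (snd v). fst w (f A) = fst v A"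
  using assms that unfolding isomorphic_def bij_betw_def by blast

lemma isomorphic_refl: "isomorphic v v"
  by (rule isomorphicI[of "\<lambda>x. x"]) auto

section \<open>Products of nanowords up to isomorphism\<close>

lemma empty_nanoword_in_nanowords: "empty_nanoword \<in> nanowords \<alpha>"
  by (simp add: empty_nanoword_def nanowords_def double_occurrence_def)

lemma isomorphic_empty: "snd w = [] \<Longrightarrow> isomorphic w empty_nanoword"
  by (rule isomorphicI[of "\<lambda>x. x"]) (auto simp: empty_nanoword_def)

text \<open>Even and odd codes never collide, so both occurrences of a letter come from the same
  factor, and injectivity of the coding carries the count 2 over.\<close>

lemma nanoword_prod_in_nanowords:
  assumes "v \<in> nanowords \<alpha>" and "w \<in> nanowords \<alpha>"
  shows "nanoword_prod v w \<in> nanowords \<alpha>"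
proof -
  have 1: "double_occurrence (snd v)" "double_occurrence (snd w)"
    "fst v ` set (snd v) \<subseteq> \<alpha>" "fst w ` set (snd w) \<subseteq> \<alpha>"
    using assms by (auto simp: nanowords_def)
  have inj: "inj (\<lambda>i::nat. 2 * i)" "inj (\<lambda>i::nat. 2 * i + 1)" by (auto intro: injI)
  have ne: "2 * i \<noteq> Suc (2 * j)" for i j :: nat by presburger
  have "count_list (map (\<lambda>i. 2 * i) (snd v) @ map (\<lambda>i. 2 * i + 1) (snd w)) A = 2"
    if A: "A \<in> set (map (\<lambda>i. 2 * i) (snd v) @ map (\<lambda>i. 2 * i + 1) (snd w))" for A
  proof -
    consider i where "i \<in> set (snd v)" "A = 2 * i" | i where "i \<in> set (snd w)" "A = 2 * i + 1"
      using A by auto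
    then show ?thesis
    proof cases
      case 1
      have "count_list (map (\<lambda>i. 2 * i + 1) (snd w)) A = 0"
        using 1 ne by (auto simp: count_list_0_iff)
      with 1 show ?thesis
        using count_list_map_conv[OF inj(1), of "snd v" i] \<open>double_occurrence (snd v)\<close>
        by (simp add: double_occurrence_def)
    next
      case 2
      have "count_list (map (\<lambda>i. 2 * i) (snd v)) A = 0"
        using 2 ne by (auto simp: count_list_0_iff dest: sym)
      with 2 show ?thesis
        using count_list_map_conv[OF inj(2), of "snd w" i] \<open>double_occurrence (snd w)\<close>
        by (simp add: double_occurrence_def)
    qed
  qed
  then show ?thesis
    using 1 by (auto simp: nanowords_def nanoword_prod_def double_occurrence_def)
qed

lemma isomorphic_nanoword_prod:
  assumes "isomorphic u u'" and "isomorphic v v'"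
  shows "isomorphic (nanoword_prod u v) (nanoword_prod u' v')"
proof -
  obtain f where f: "inj_on f (set (snd u))" "snd u' = map f (snd u)"
    "\<forall>A\<in>set (snd u). fst u' (f A) = fst u A" using assms(1) by (rule isomorphicE)
  obtain g where g: "inj_on g (set (snd v))" "snd v' = map g (snd v)"
    "\<forall>A\<in>set (snd v). fst v' (g A) = fst v A" using assms(2) by (rule isomorphicE)
  \<comment> \<open>The recoding preserves parity: it acts by \<open>f\<close> on the letters from
    \<open>u\<close> and by \<open>g\<close> on those from \<open>v\<close>, so injectivity can be
    checked on each parity separately.\<close>
  let ?h = "\<lambda>i. if even i then 2 * f (i div 2) else 2 * g (i div 2) + 1"
  show ?thesis
  proof (rule isomorphicI[of ?h])
    show "inj_on ?h (set (snd (nanoword_prod u v)))"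
    proof (rule inj_onI)
      fix x y
      assume x: "x \<in> set (snd (nanoword_prod u v))" and y: "y \<in> set (snd (nanoword_prod u v))"
        and "?h x = ?h y"
      then have "even x = even y" by (metis even_plus_one_iff even_mult_iff dvd_refl)
      have z: "if even z then z div 2 \<in> set (snd u) else z div 2 \<in> set (snd v)"
        if "z \<in> set (snd (nanoword_prod u v))" for z
        using that by (auto simp: nanoword_prod_def)
      have "x div 2 = y div 2"
      proof (cases "even x")
        case True
        then have "f (x div 2) = f (y div 2)" using \<open>?h x = ?h y\<close> \<open>even x = even y\<close> by simp
        then show ?thesis using z[OF x] z[OF y] True \<open>even x = even y\<close> inj_onD[OF f(1)] by simp
      next
        case False
        then have "g (x div 2) = g (y div 2)" using \<open>?h x = ?h y\<close> \<open>even x = even y\<close> by simp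
        then show ?thesis using z[OF x] z[OF y] False \<open>even x = even y\<close> inj_onD[OF g(1)] by simp
      qed
      then show "x = y"
        using \<open>even x = even y\<close> by (metis even_two_times_div_two odd_two_times_div_two_succ)
    qed
    show "snd (nanoword_prod u' v') = map ?h (snd (nanoword_prod u v))"
      using f(2) g(2) by (simp add: nanoword_prod_def)
    show "fst (nanoword_prod u' v') (?h A) = fst (nanoword_prod u v) A"
      if "A \<in> set (snd (nanoword_prod u v))" for A
      using that f(3) g(3) by (auto simp: nanoword_prod_def)
  qed
qed

lemma isomorphic_nanoword_prod_assoc:
  "isomorphic (nanoword_prod (nanoword_prod u v) w) (nanoword_prod u (nanoword_prod v w))"
proof -
  \<comment> \<open>A letter \<open>i\<close> of \<open>u\<close>, \<open>v\<close>,
    \<open>w\<close> is coded as 4i, 4i+2, 2i+1 in the left bracketing and as 2i, 4i+1, 4i+3 in the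
    right one. \<open>?h\<close> translates the first code into the second, and \<open>?k\<close>
    undoes it.\<close>
  let ?h = "\<lambda>n::nat. if odd n then 2 * n + 1 else if even (n div 2) then n div 2 else n - 1"
  let ?k = "\<lambda>n::nat. if even n then 2 * n else if even (n div 2) then n + 1 else n div 2"
  have k: "?k (?h n) = n" for n
  proof (cases "odd n")
    case False
    then obtain m where m: "n = 2 * m" by (auto elim: evenE)
    show ?thesis by (cases "even m") (auto simp: m elim: oddE)
  qed simp
  show ?thesis
  proof (rule isomorphicI[of ?h])
    show "inj_on ?h (set (snd (nanoword_prod (nanoword_prod u v) w)))"
      using k by (rule inj_on_inverseI)
  qed (auto simp: nanoword_prod_def)
qed

lemma isomorphic_nanoword_prod_empty_left: "isomorphic (nanoword_prod empty_nanoword w) w"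
  \<comment> \<open>Halving undoes both codes 2i and 2i+1; it is injective here because only one
    parity occurs.\<close>
  by (rule isomorphicI[of "\<lambda>n. n div 2"])
    (auto simp: nanoword_prod_def empty_nanoword_def inj_on_def o_def)

lemma isomorphic_nanoword_prod_empty_right: "isomorphic (nanoword_prod w empty_nanoword) w"
  by (rule isomorphicI[of "\<lambda>n. n div 2"])
    (auto simp: nanoword_prod_def empty_nanoword_def inj_on_def o_def)


section \<open>Moves on a subword\<close>

text \<open>The words around the letters of a move are arbitrary, so the context \<open>a\<close>,
  \<open>b\<close> is absorbed into the outermost ones. Injectivity of \<open>f\<close> keeps the
  three letters of the third move distinct.\<close>

lemma homotopy_move_subword:
  assumes "homotopy_move \<tau> p u v" and "inj f" and p': "\<And>A. p' (f A) = p A"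
  shows "homotopy_move \<tau> p' (a @ map f u @ b) (a @ map f v @ b)"
  using assms(1)
proof cases
  case (move1 x A y)
  then show ?thesis
    using homotopy_move.move1[of \<tau> p' "a @ map f x" "f A" "map f y @ b"] by simp
next
  case (move2 B A x y z)
  then show ?thesis
    using homotopy_move.move2[of p' "f B" \<tau> "f A" "a @ map f x" "map f y" "map f z @ b"] p'
    by simp
next
  case (move3 A B C x y z t)
  have "distinct [f A, f B, f C]" using move3 \<open>inj f\<close> by (auto dest: injD)
  then show ?thesis
    using homotopy_move.move3[of "f A" "f B" "f C" p' \<tau> "a @ map f x" "map f y" "map f z" "map f t @ b"]
      p' move3 by simp
qed

lemma double_occurrence_map:
  assumes "inj f" and "double_occurrence w"
  shows "double_occurrence (map f w)"
  using assms by (auto simp: double_occurrence_def count_list_map_conv)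

lemma factor_removal_subword:
  assumes "factor_removal vs u v" and "inj f" and "vs \<noteq> []"
    and disj: "f ` set u \<inter> (set a \<union> set b) = {}"
  shows "factor_removal (map (map f) vs) (a @ map f u @ b) (a @ map f v @ b)"
proof -
  obtain xs z where np: "nanophrase vs" and len: "length xs = length vs"
    and u: "u = concat (map2 (@) xs vs) @ z" and v: "v = concat xs @ z"
    and vd: "set v \<inter> set (concat vs) = {}"
    using assms(1) by (auto simp: factor_removal_def)
  from \<open>vs \<noteq> []\<close> obtain w ws where vs: "vs = w # ws" by (cases vs) auto
  with len obtain y ys where xs: "xs = y # ys" by (cases xs) auto
  \<comment> \<open>The left context joins the first complementary word, which exists as
    \<open>vs\<close> is nonempty; the right context joins the last one, \<open>z\<close>.\<close>
  let ?xs = "(a @ map f y) # map (map f) ys"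
  have m: "concat (map2 (@) (map (map f) as) (map (map f) bs)) = map f (concat (map2 (@) as bs))"
    if "length as = length bs" for as bs
    using that by (induction as bs rule: list_induct2) auto
  have sub: "set (concat bs) \<subseteq> set (concat (map2 (@) as bs))"
    if "length as = length bs" for as bs :: "nat list list"
    using that by (induction as bs rule: list_induct2) auto
  have vsu: "set (concat vs) \<subseteq> set u" using sub[OF len] u by auto
  show ?thesis
    unfolding factor_removal_def
  proof (intro conjI exI[of _ ?xs] exI[of _ "map f z @ b"])
    show "nanophrase (map (map f) vs)"
      using np \<open>inj f\<close> double_occurrence_map unfolding nanophrase_def by (metis map_concat)
    show "length ?xs = length (map (map f) vs)" using len xs by simp
    show "a @ map f u @ b = concat (map2 (@) ?xs (map (map f) vs)) @ map f z @ b"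
      using m[of ys ws] len by (simp add: u xs vs)
    show "a @ map f v @ b = concat ?xs @ map f z @ b"
      by (simp add: v xs map_concat)
    have 1: "set (concat (map (map f) vs)) = f ` set (concat vs)" by auto
    have 2: "f ` set v \<inter> f ` set (concat vs) = {}"
      using vd \<open>inj f\<close> by (metis image_Int image_empty)
    have 3: "f ` set (concat vs) \<inter> (set a \<union> set b) = {}"
      using disj image_mono[OF vsu, of f] by (blast dest: subsetD)
    show "set (a @ map f v @ b) \<inter> set (concat (map (map f) vs)) = {}"
      unfolding 1 set_append set_map using 2 3
      by (simp add: Int_Un_distrib2 Int_Un_distrib Int_commute del: set_concat)
  qed
qed

lemma leftmost_map:
  assumes "inj f"
  shows "leftmost (map (map f) vs) (f B) r j \<longleftrightarrow> leftmost vs B r j"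
  using assms unfolding leftmost_def by (auto simp: inj_eq cong: conj_cong)

lemma bridge_map:
  assumes "bridge \<tau> p vs \<kappa>" and "inj f" and p': "\<And>A. p' (f A) = p A"
  shows "bridge \<tau> p' (map (map f) vs) \<kappa>"
proof -
  obtain \<iota> where q: "quasi_bridge vs \<kappa> \<iota>"
    and \<iota>: "\<forall>B\<in>set (concat vs). p (\<iota> B) = (\<tau> ^^ bridge_eps vs \<kappa> \<iota> B) (p B)"
    using assms(1) unfolding bridge_def by blast
  \<comment> \<open>The symmetry is conjugated by the renaming. Its values off the range of
    \<open>f\<close> are arbitrary, but every letter of the renamed phrase lies in that
    range.\<close>
  let ?i = "\<lambda>x. f (\<iota> (inv_into UNIV f x))"
  have i: "?i (f A) = f (\<iota> A)" for A using \<open>inj f\<close> by simp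
  have qb: "quasi_bridge (map (map f) vs) \<kappa> ?i"
    unfolding quasi_bridge_def
  proof (intro conjI allI impI)
    show "?i ` set (concat (map (map f) vs)) \<subseteq> set (concat (map (map f) vs))"
      using q i by (fastforce simp: quasi_bridge_def)
    fix r assume r: "r < length (map (map f) vs)"
    then have "map \<iota> (vs ! r) = rev (vs ! \<kappa> r)" "\<kappa> r < length vs" using q by (auto simp: quasi_bridge_def)
    moreover have "map ?i (map f (vs ! r)) = map f (map \<iota> (vs ! r))" using \<open>inj f\<close> by simp
    ultimately show "map ?i (map (map f) vs ! r) = rev (map (map f) vs ! \<kappa> r)"
      using r by (simp add: rev_map)
  qed (use q in \<open>auto simp: quasi_bridge_def\<close>)
  have e: "bridge_eps (map (map f) vs) \<kappa> ?i (f B) = bridge_eps vs \<kappa> \<iota> B" for B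
  proof -
    have "leftmost (map (map f) vs) (f B) r j \<and>
        leftmost (map (map f) vs) (?i (f B)) (\<kappa> r) (length (map (map f) vs ! r) - 1 - j) \<longleftrightarrow>
      leftmost vs B r j \<and> leftmost vs (\<iota> B) (\<kappa> r) (length (vs ! r) - 1 - j)" for r j
      unfolding i leftmost_map[OF \<open>inj f\<close>]
      \<comment> \<open>Out of range both sides are false by the definition of
        \<open>leftmost\<close>; in range the renamed word has the same length.\<close>
      by (cases "r < length vs") (auto simp: leftmost_def)
    then show ?thesis unfolding bridge_eps_def by simp
  qed
  have "p' (?i C) = (\<tau> ^^ bridge_eps (map (map f) vs) \<kappa> ?i C) (p' C)"
    if C: "C \<in> set (concat (map (map f) vs))" for C
  proof -
    obtain B where "C = f B" and B: "B \<in> set (concat vs)" using C by auto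
    then show ?thesis using bspec[OF \<iota> B] e[of B] i[of B] p' by simp
  qed
  then show ?thesis using qb unfolding bridge_def by blast
qed

lemma arches_map: "arches (map (map f) vs) \<kappa> = arches vs \<kappa>"
  by (simp add: arches_def)

lemma bridge_move_subword:
  assumes "bridge_move \<tau> p g u v" and "inj f" and "\<And>A. p' (f A) = p A"
    and "f ` set u \<inter> (set a \<union> set b) = {}"
  shows "bridge_move \<tau> p' g (a @ map f u @ b) (a @ map f v @ b)"
proof -
  obtain vs \<kappa> where fr: "factor_removal vs u v" and br: "bridge \<tau> p vs \<kappa>" and g: "g = arches vs \<kappa>"
    using assms(1) unfolding bridge_move_def by blast
  have "vs \<noteq> []" using br by (auto simp: bridge_def quasi_bridge_def)
  then show ?thesis
    unfolding bridge_move_def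
    using factor_removal_subword[OF fr assms(2) _ assms(4)] bridge_map[OF br assms(2,3)] g arches_map
    by metis
qed

text \<open>The moved factor sits in the product through the odd codes, the context \<open>x\<close>
  through the even ones. Moves keep the projection fixed, so the projections of the two products
  must also be seen to coincide.\<close>

lemma elementary_move_nanoword_prod_left:
  assumes m: "elementary_move \<alpha> \<tau> g u v" and x: "x \<in> nanowords \<alpha>"
  shows "elementary_move \<alpha> \<tau> g (nanoword_prod x u) (nanoword_prod x v)"
proof -
  let ?f = "\<lambda>i::nat. 2 * i + 1" and ?a = "map (\<lambda>i. 2 * i) (snd x)"
  let ?p = "fst (nanoword_prod x u)"
  have f: "inj ?f" by (auto intro: injI)
  have p: "?p (?f A) = fst u A" for A by (simp add: nanoword_prod_def)
  have s: "snd (nanoword_prod x w) = ?a @ map ?f (snd w) @ []" for w :: "'a nanoword"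
    by (simp add: nanoword_prod_def)
  have d: "?f ` set (snd u) \<inter> (set ?a \<union> set []) = {}" by auto presburger
  have n: "nanoword_prod x u \<in> nanowords \<alpha>" "nanoword_prod x v \<in> nanowords \<alpha>"
    using m x by (auto simp: elementary_move_def nanoword_prod_in_nanowords)
  have e: "fst (nanoword_prod x u) = fst (nanoword_prod x v)" if "fst u = fst v"
    unfolding nanoword_prod_def that by simp
  consider "g = 0" "isomorphic u v"
    | "g = 0" "fst u = fst v" "homotopy_move \<tau> (fst u) (snd u) (snd v)"
    | "fst u = fst v" "bridge_move \<tau> (fst u) g (snd u) (snd v)"
    using m by (auto simp: elementary_move_def)
  then show ?thesis
  proof cases
    case 1
    then show ?thesis
      using n isomorphic_nanoword_prod[OF isomorphic_refl, of u v x] by (simp add: elementary_move_def)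
  next
    case 2
    then show ?thesis
      using n e homotopy_move_subword[OF 2(3) f p] unfolding elementary_move_def s by metis
  next
    case 3
    then show ?thesis
      using n e bridge_move_subword[OF 3(2) f p d] unfolding elementary_move_def s by metis
  qed
qed

lemma elementary_move_nanoword_prod_right:
  assumes m: "elementary_move \<alpha> \<tau> g u v" and x: "x \<in> nanowords \<alpha>"
  shows "elementary_move \<alpha> \<tau> g (nanoword_prod u x) (nanoword_prod v x)"
proof -
  let ?f = "\<lambda>i::nat. 2 * i" and ?b = "map (\<lambda>i. 2 * i + 1) (snd x)"
  let ?p = "fst (nanoword_prod u x)"
  have f: "inj ?f" by (auto intro: injI)
  have p: "?p (?f A) = fst u A" for A by (simp add: nanoword_prod_def)
  have s: "snd (nanoword_prod w x) = [] @ map ?f (snd w) @ ?b" for w :: "'a nanoword"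
    by (simp add: nanoword_prod_def)
  have d: "?f ` set (snd u) \<inter> (set [] \<union> set ?b) = {}" by auto presburger
  have n: "nanoword_prod u x \<in> nanowords \<alpha>" "nanoword_prod v x \<in> nanowords \<alpha>"
    using m x by (auto simp: elementary_move_def nanoword_prod_in_nanowords)
  have e: "fst (nanoword_prod u x) = fst (nanoword_prod v x)" if "fst u = fst v"
    unfolding nanoword_prod_def that by simp
  consider "g = 0" "isomorphic u v"
    | "g = 0" "fst u = fst v" "homotopy_move \<tau> (fst u) (snd u) (snd v)"
    | "fst u = fst v" "bridge_move \<tau> (fst u) g (snd u) (snd v)"
    using m by (auto simp: elementary_move_def)
  then show ?thesis
  proof cases
    case 1
    then show ?thesis
      using n isomorphic_nanoword_prod[OF _ isomorphic_refl, of u v x] by (simp add: elementary_move_def)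
  next
    case 2
    then show ?thesis
      using n e homotopy_move_subword[OF 2(3) f p] unfolding elementary_move_def s by metis
  next
    case 3
    then show ?thesis
      using n e bridge_move_subword[OF 3(2) f p d] unfolding elementary_move_def s by metis
  qed
qed


section \<open>Surgeries as bridge moves without arches\<close>

lemma count_list_eq_card: "count_list xs x = card {i. i < length xs \<and> xs ! i = x}"
  by (simp add: count_list_eq_length_filter length_filter_conv_card eq_commute)

lemma count_list_two_other_position:
  assumes "count_list xs x = 2"
  obtains j where "j < length xs" and "xs ! j = x" and "j \<noteq> i"
proof -
  have "card {i. i < length xs \<and> xs ! i = x} = 2" using assms by (simp add: count_list_eq_card)
  then have "\<exists>j\<in>{i. i < length xs \<and> xs ! i = x}. j \<noteq> i"
    by (metis (no_types, lifting) card_2_iff insertCI)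
  then show ?thesis using that by blast
qed

lemma count_list_ge_two:
  assumes "i < length xs" "j < length xs" "xs ! i = x" "xs ! j = x" "i \<noteq> j"
  shows "2 \<le> count_list xs x"
proof -
  have "card {i, j} \<le> card {i. i < length xs \<and> xs ! i = x}"
    by (rule card_mono) (use assms in auto)
  then show ?thesis using assms by (simp add: count_list_eq_card)
qed

lemma count_list_concat: "count_list (concat vs) B = (\<Sum>r<length vs. count_list (vs ! r) B)"
proof (induction vs)
  case (Cons v vs)
  then show ?case by (simp add: sum.lessThan_Suc_shift del: sum.lessThan_Suc)
qed simp

lemma count_list_concat_ge:
  assumes "r < length vs"
  shows "count_list (vs ! r) B \<le> count_list (concat vs) B"
  unfolding count_list_concat by (rule member_le_sum) (use assms in auto)

lemma count_list_concat_ge2: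
  assumes "r < length vs" and "s < length vs" and "r \<noteq> s"
  shows "count_list (vs ! r) B + count_list (vs ! s) B \<le> count_list (concat vs) B"
proof -
  have "(\<Sum>t\<in>{r, s}. count_list (vs ! t) B) \<le> (\<Sum>t<length vs. count_list (vs ! t) B)"
    by (rule sum_mono2) (use assms in auto)
  then show ?thesis using assms by (simp add: count_list_concat)
qed

text \<open>Positions are ordered lexicographically: the least word containing \<open>B\<close> is
  chosen, then the least position in it.\<close>

lemma leftmost_exists:
  assumes "B \<in> set (concat vs)"
  obtains r j where "leftmost vs B r j"
proof -
  have ex: "\<exists>r. r < length vs \<and> B \<in> set (vs ! r)"
    using assms by (auto simp: in_set_conv_nth) (metis nth_mem)
  define r where "r = (LEAST r. r < length vs \<and> B \<in> set (vs ! r))"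
  have r: "r < length vs" "B \<in> set (vs ! r)" using LeastI_ex[OF ex] by (auto simp: r_def)
  have ex2: "\<exists>j. j < length (vs ! r) \<and> vs ! r ! j = B" using r(2) by (auto simp: in_set_conv_nth)
  define j where "j = (LEAST j. j < length (vs ! r) \<and> vs ! r ! j = B)"
  have j: "j < length (vs ! r)" "vs ! r ! j = B" using LeastI_ex[OF ex2] by (auto simp: j_def)
  have "r < r' \<or> r = r' \<and> j \<le> j'"
    if j': "r' < length vs" "j' < length (vs ! r')" "vs ! r' ! j' = B" for r' j'
  proof -
    have "r \<le> r'" unfolding r_def by (rule Least_le) (use j' in auto)
    moreover have "j \<le> j'" if "r = r'"
      unfolding j_def by (rule Least_le) (use that j' in auto)
    ultimately show ?thesis by linarith
  qed
  then show ?thesis using that r j unfolding leftmost_def by blast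
qed

text \<open>If \<kappa> fixes all words, symmetry reflects each word in itself. When both
  occurrences of \<open>B\<close> lie in one word, the reflection reverses their order, so leftmost
  goes to rightmost and the exponent is 0. When they lie in two words, each word stays in its place
  and leftmost goes to leftmost, which gives 1.\<close>

lemma bridge_eps_eq_phrase_eps:
  assumes np: "nanophrase vs" and B: "B \<in> set (concat vs)"
    and inj: "inj_on \<iota> (set (concat vs))"
    and \<iota>: "\<And>r. r < length vs \<Longrightarrow> map \<iota> (vs ! r) = rev (vs ! r)"
    and \<kappa>: "\<And>r. r < length vs \<Longrightarrow> \<kappa> r = r"
  shows "bridge_eps vs \<kappa> \<iota> B = phrase_eps vs B"
proof -
  have mirror: "vs ! r ! (length (vs ! r) - 1 - j) = \<iota> (vs ! r ! j)"
    if "r < length vs" "j < length (vs ! r)" for r j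
    using arg_cong[OF \<iota>[OF that(1)], of "\<lambda>l. l ! j"] that by (simp add: rev_nth)
  have two: "count_list (concat vs) B = 2"
    using np B unfolding nanophrase_def double_occurrence_def by blast
  show ?thesis
  proof (cases "\<exists>r<length vs. count_list (vs ! r) B = 2")
    case True
    then obtain r where r: "r < length vs" "count_list (vs ! r) B = 2" by blast
    have False
      if l: "leftmost vs B s j" and l': "leftmost vs (\<iota> B) (\<kappa> s) (length (vs ! s) - 1 - j)" for s j
    proof -
      have s: "s < length vs" "j < length (vs ! s)" "vs ! s ! j = B"
        and le: "\<And>j'. j' < length (vs ! s) \<Longrightarrow> vs ! s ! j' = B \<Longrightarrow> j \<le> j'"
        using l by (auto simp: leftmost_def)
      then have "B \<in> set (vs ! s)" by auto
      then have "count_list (vs ! s) B \<noteq> 0" by (simp add: count_list_0_iff)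
      \<comment> \<open>Otherwise \<open>s\<close> would contribute a third occurrence of
        \<open>B\<close>.\<close>
      then have "s = r" using count_list_concat_ge2[of s vs r B] r s two by fastforce
      then obtain j' where j': "j' < length (vs ! s)" "vs ! s ! j' = B" "j' \<noteq> j"
        using r count_list_two_other_position by metis
      then have "j < j'" using le by fastforce
      \<comment> \<open>The second occurrence \<open>j'\<close> of \<open>B\<close> is mirrored to
        an occurrence of \<open>\<iota> B\<close>, which cannot precede the leftmost one; yet
        mirroring turns \<open>j < j'\<close> around.\<close>
      have "length (vs ! s) - 1 - j \<le> length (vs ! s) - 1 - j'"
        using l' \<kappa>[OF s(1)] s j' mirror[OF s(1) j'(1)] unfolding leftmost_def
        by (metis diff_less length_greater_0_conv length_pos_if_in_set less_imp_diff_less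
            less_irrefl less_numeral_extra(1) nth_mem)
      then show False using \<open>j < j'\<close> j' by linarith
    qed
    then show ?thesis using True unfolding bridge_eps_def phrase_eps_def by auto
  next
    case False
    obtain r j where l: "leftmost vs B r j" using B by (rule leftmost_exists)
    then have r: "r < length vs" "j < length (vs ! r)" "vs ! r ! j = B" by (auto simp: leftmost_def)
    let ?j = "length (vs ! r) - 1 - j"
    have "leftmost vs (\<iota> B) r ?j"
      unfolding leftmost_def
    proof (intro conjI allI impI)
      show "vs ! r ! ?j = \<iota> B" using mirror[OF r(1,2)] r(3) by simp
      fix r' j'
      assume "r' < length vs \<and> j' < length (vs ! r') \<and> vs ! r' ! j' = \<iota> B"
      then have r': "r' < length vs" "j' < length (vs ! r')" "vs ! r' ! j' = \<iota> B" by auto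
      let ?j' = "length (vs ! r') - 1 - j'"
      have j': "?j' < length (vs ! r')" using r' by simp
      have "length (vs ! r') - 1 - ?j' = j'" using r' by simp
      then have "\<iota> (vs ! r' ! ?j') = \<iota> B" using mirror[OF r'(1) j'] r'(3) by simp
      moreover have "vs ! r' ! ?j' \<in> set (concat vs)" using r' j' by (auto intro!: bexI[of _ "vs ! r'"])
      \<comment> \<open>Injectivity of \<iota> pulls an arbitrary occurrence of
        \<open>\<iota> B\<close> back to one of \<open>B\<close>, where minimality of
        \<open>r\<close> applies. Inside the word \<open>r\<close> there is just one
        \<open>B\<close>, so the position is forced as well.\<close>
      ultimately have b: "vs ! r' ! ?j' = B" using inj B by (auto dest: inj_onD)
      then have "r < r' \<or> r = r'" using l r' j' unfolding leftmost_def by blast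
      moreover have "?j \<le> j'" if "r = r'"
      proof (rule ccontr)
        assume "\<not> ?j \<le> j'"
        moreover have "length (vs ! r') = length (vs ! r)" using that by simp
        ultimately have "j \<noteq> ?j'" using r(2) r'(2) by linarith
        then have "2 \<le> count_list (vs ! r) B"
          using count_list_ge_two[of j "vs ! r" ?j' B] r j' b that by simp
        then show False using False r count_list_concat_ge[of r vs B] two by fastforce
      qed
      ultimately show "r < r' \<or> r = r' \<and> ?j \<le> j'" by blast
    qed (use r in auto)
    then have "leftmost vs (\<iota> B) (\<kappa> r) ?j" by (simp add: \<kappa>[OF r(1)])
    with l have "\<exists>r j. leftmost vs B r j \<and> leftmost vs (\<iota> B) (\<kappa> r) (length (vs ! r) - 1 - j)"
      by blast
    then show ?thesis using False by (simp only: bridge_eps_def phrase_eps_def if_True if_False)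
  qed
qed

text \<open>The alternative \<open>w = w'\<close> accounts for the surgery along the phrase with no
  words, which is not a bridge.\<close>

lemma surgery_imp_bridge_move:
  assumes "surgery \<tau> p w w'"
  shows "w = w' \<or> bridge_move \<tau> p 0 w w'"
proof -
  obtain vs \<iota> where fr: "factor_removal vs w w'" and ev: "even_phrase vs"
    and bij: "bij_betw \<iota> (set (concat vs)) (set (concat vs))"
    and \<iota>: "\<And>r. r < length vs \<Longrightarrow> map \<iota> (vs ! r) = rev (vs ! r)"
    and p: "\<And>B. B \<in> set (concat vs) \<Longrightarrow> p (\<iota> B) = (\<tau> ^^ phrase_eps vs B) (p B)"
    using assms unfolding surgery_def symmetric_phrase_def by blast
  show ?thesis
  proof (cases "vs = []")
    case True
    then show ?thesis using fr by (auto simp: factor_removal_def)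
  next
    case False
    have np: "nanophrase vs" using fr by (simp add: factor_removal_def)
    have "quasi_bridge vs (\<lambda>r. r) \<iota>"
      using False ev bij \<iota> by (auto simp: quasi_bridge_def even_phrase_def bij_betw_def Suc_le_eq)
    then have "bridge \<tau> p vs (\<lambda>r. r)"
      unfolding bridge_def
      using p bridge_eps_eq_phrase_eps[OF np _ bij_betw_imp_inj_on[OF bij] \<iota>] by metis
    moreover have "arches vs (\<lambda>r. r) = 0" by (simp add: arches_def)
    ultimately show ?thesis using fr unfolding bridge_move_def by metis
  qed
qed

lemma bridge_move_zero_imp_surgery:
  assumes "bridge_move \<tau> p 0 w w'"
  shows "surgery \<tau> p w w'"
proof -
  obtain vs \<kappa> \<iota> where fr: "factor_removal vs w w'" and ar: "arches vs \<kappa> = 0"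
    and q: "quasi_bridge vs \<kappa> \<iota>"
    and p: "\<And>B. B \<in> set (concat vs) \<Longrightarrow> p (\<iota> B) = (\<tau> ^^ bridge_eps vs \<kappa> \<iota> B) (p B)"
    using assms unfolding bridge_move_def bridge_def by metis
  have np: "nanophrase vs" using fr by (simp add: factor_removal_def)
  \<comment> \<open>Finiteness matters: \<open>card\<close> is also 0 on infinite sets, so only now
    does the absence of arches show that \<kappa> fixes every word.\<close>
  have "{{r, \<kappa> r} | r. r < length vs \<and> \<kappa> r \<noteq> r} \<subseteq> (\<lambda>r. {r, \<kappa> r}) ` {..<length vs}" by auto
  then have "finite {{r, \<kappa> r} | r. r < length vs \<and> \<kappa> r \<noteq> r}"
    by (rule finite_subset) simp
  then have "{{r, \<kappa> r} | r. r < length vs \<and> \<kappa> r \<noteq> r} = {}"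
    using ar by (simp add: arches_def)
  then have \<kappa>: "\<kappa> r = r" if "r < length vs" for r using that by blast
  have \<iota>: "map \<iota> (vs ! r) = rev (vs ! r)" if "r < length vs" for r
    using q \<kappa> that by (simp add: quasi_bridge_def)
  \<comment> \<open>A quasi-bridge provides only a map \<iota>. As it reverses each word, it maps
    the letters of that word onto themselves; being onto a finite alphabet, it is injective.\<close>
  have "set (concat vs) \<subseteq> \<iota> ` set (concat vs)"
  proof
    fix B assume "B \<in> set (concat vs)"
    then obtain v where v: "v \<in> set vs" "B \<in> set v" by auto
    then obtain r where "r < length vs" "vs ! r = v" by (auto simp: in_set_conv_nth)
    then have "\<iota> ` set v = set v" using arg_cong[OF \<iota>, of r set] by simp
    then show "B \<in> \<iota> ` set (concat vs)" using v by auto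
  qed
  then have im: "\<iota> ` set (concat vs) = set (concat vs)" using q unfolding quasi_bridge_def by blast
  then have inj: "inj_on \<iota> (set (concat vs))" by (intro eq_card_imp_inj_on) auto
  have "even_phrase vs" using q \<kappa> by (simp add: quasi_bridge_def even_phrase_def)
  moreover have "symmetric_phrase \<tau> p vs"
    unfolding symmetric_phrase_def
    using im inj \<iota> p bridge_eps_eq_phrase_eps[OF np _ inj \<iota> \<kappa>] unfolding bij_betw_def by metis
  ultimately show ?thesis using fr unfolding surgery_def by blast
qed


section \<open>Metamorphoses\<close>

lemma metamorphosis_in_nanowords:
  "metamorphosis \<alpha> \<tau> n v w \<Longrightarrow> v \<in> nanowords \<alpha> \<and> w \<in> nanowords \<alpha>"
  by (induction rule: metamorphosis.induct) (auto simp: elementary_move_def)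

lemma metamorphosis_elementary:
  assumes "elementary_move \<alpha> \<tau> g v w"
  shows "metamorphosis \<alpha> \<tau> g v w" and "metamorphosis \<alpha> \<tau> g w v"
proof -
  have "v \<in> nanowords \<alpha>" "w \<in> nanowords \<alpha>" using assms by (auto simp: elementary_move_def)
  then show "metamorphosis \<alpha> \<tau> g v w" "metamorphosis \<alpha> \<tau> g w v"
    using assms metamorphosis.step[OF _ metamorphosis.refl, of \<alpha> \<tau> g] by fastforce+
qed

lemma metamorphosis_trans:
  "metamorphosis \<alpha> \<tau> m u v \<Longrightarrow> metamorphosis \<alpha> \<tau> n v w \<Longrightarrow> metamorphosis \<alpha> \<tau> (m + n) u w"
  by (induction rule: metamorphosis.induct) (auto simp: add.assoc intro: metamorphosis.step)

lemma metamorphosis_sym: "metamorphosis \<alpha> \<tau> n v w \<Longrightarrow> metamorphosis \<alpha> \<tau> n w v"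
proof (induction rule: metamorphosis.induct)
  case (step g u v n w)
  then have "metamorphosis \<alpha> \<tau> g v u" using metamorphosis_elementary by blast
  with step.IH show ?case using metamorphosis_trans by (metis add.commute)
qed (rule metamorphosis.refl)

lemma metamorphosis_isomorphic:
  "v \<in> nanowords \<alpha> \<Longrightarrow> w \<in> nanowords \<alpha> \<Longrightarrow> isomorphic v w \<Longrightarrow> metamorphosis \<alpha> \<tau> 0 v w"
  by (rule metamorphosis_elementary) (simp add: elementary_move_def)

lemma metamorphosis_nanoword_prod_left:
  assumes "metamorphosis \<alpha> \<tau> n u v" and "x \<in> nanowords \<alpha>"
  shows "metamorphosis \<alpha> \<tau> n (nanoword_prod x u) (nanoword_prod x v)"
  using assms
  by (induction rule: metamorphosis.induct)
    (auto intro: metamorphosis.intros elementary_move_nanoword_prod_left nanoword_prod_in_nanowords)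

lemma metamorphosis_nanoword_prod_right:
  assumes "metamorphosis \<alpha> \<tau> n u v" and "x \<in> nanowords \<alpha>"
  shows "metamorphosis \<alpha> \<tau> n (nanoword_prod u x) (nanoword_prod v x)"
  using assms
  by (induction rule: metamorphosis.induct)
    (auto intro: metamorphosis.intros elementary_move_nanoword_prod_right nanoword_prod_in_nanowords)

text \<open>One factor is transformed at a time, so the arches add up. This is the source of the
  triangle inequality.\<close>

lemma metamorphosis_nanoword_prod:
  assumes "metamorphosis \<alpha> \<tau> m u u'" and "metamorphosis \<alpha> \<tau> n v v'"
  shows "metamorphosis \<alpha> \<tau> (m + n) (nanoword_prod u v) (nanoword_prod u' v')"
  using assms metamorphosis_nanoword_prod_left metamorphosis_nanoword_prod_right
    metamorphosis_trans metamorphosis_in_nanowords by metis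

lemma metamorphosis_surgery:
  assumes "v \<in> nanowords \<alpha>" and "w \<in> nanowords \<alpha>" and "fst v = fst w"
    and "surgery \<tau> (fst v) (snd v) (snd w)"
  shows "metamorphosis \<alpha> \<tau> 0 v w"
proof (rule metamorphosis_elementary)
  \<comment> \<open>A surgery that removes nothing is replaced by the identity isomorphism.\<close>
  show "elementary_move \<alpha> \<tau> 0 v w"
    using surgery_imp_bridge_move[OF assms(4)] assms(1,2,3) isomorphic_refl
    unfolding elementary_move_def by (metis prod_eqI)
qed

section \<open>Opposite words as inverses\<close>

definition opposite :: "'a nanoword \<Rightarrow> 'a nanoword" where
  "opposite w = (fst w, rev (snd w))"

lemma opposite_in_nanowords: "w \<in> nanowords \<alpha> \<Longrightarrow> opposite w \<in> nanowords \<alpha>"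
  by (auto simp: opposite_def nanowords_def double_occurrence_def)

text \<open>The whole word \<open>w\<^sup>- w\<close> is a one-word symmetric factor: exchanging the two copies of each letter
  reverses it.\<close>

lemma metamorphosis_opposite_prod:
  assumes w: "w \<in> nanowords \<alpha>"
  shows "metamorphosis \<alpha> \<tau> 0 (nanoword_prod (opposite w) w) empty_nanoword"
proof -
  let ?v = "nanoword_prod (opposite w) w"
  \<comment> \<open>The codes 2i and 2i+1 are the two copies of the letter \<open>i\<close>, in
    \<open>w\<^sup>-\<close> and in \<open>w\<close>; \<open>?i\<close> swaps them. The truncated
    subtraction acts on odd numbers only.\<close>
  let ?i = "\<lambda>n::nat. if even n then n + 1 else n - 1"
  have v: "?v \<in> nanowords \<alpha>" using w by (simp add: nanoword_prod_in_nanowords opposite_in_nanowords)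
  then have d: "double_occurrence (snd ?v)" by (auto simp: nanowords_def)
  have m: "map ?i (snd ?v) = rev (snd ?v)"
    by (simp add: nanoword_prod_def opposite_def rev_map o_def)
  have inj: "inj ?i"
  proof (rule injI)
    fix m n assume "?i m = ?i n"
    then show "m = n" by (auto split: if_splits) presburger+
  qed
  have "surgery \<tau> (fst ?v) (snd ?v) []"
    unfolding surgery_def
  proof (intro exI conjI)
    show "factor_removal [snd ?v] (snd ?v) []"
      unfolding factor_removal_def using d
      by (auto simp: nanophrase_def intro!: exI[of _ "[[]]"])
    show "even_phrase [snd ?v]"
      by (simp add: even_phrase_def nanoword_prod_def opposite_def)
    show "symmetric_phrase \<tau> (fst ?v) [snd ?v]"
      unfolding symmetric_phrase_def
    proof (intro exI[of _ ?i] conjI ballI allI impI)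
      show "bij_betw ?i (set (concat [snd ?v])) (set (concat [snd ?v]))"
        using arg_cong[OF m, of set] inj_on_subset[OF inj] by (simp add: bij_betw_def)
      show "map ?i ([snd ?v] ! r) = rev ([snd ?v] ! r)" if "r < length [snd ?v]" for r
        using that m by simp
      fix B assume "B \<in> set (concat [snd ?v])"
      \<comment> \<open>There is a single word, so \<tau> enters with exponent 0 and it suffices
        that the two copies of a letter have equal projections.\<close>
      then have "phrase_eps [snd ?v] B = 0"
        using d by (simp add: phrase_eps_def double_occurrence_def)
      then show "fst ?v (?i B) = (\<tau> ^^ phrase_eps [snd ?v] B) (fst ?v B)"
        by (auto simp: nanoword_prod_def opposite_def elim!: oddE)
    qed
  qed
  \<comment> \<open>A surgery keeps the projection, so it ends in an empty word with the projection
    of \<open>?v\<close>; an isomorphism then leads to \<open>empty_nanoword\<close>.\<close>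
  moreover have e: "(fst ?v, []) \<in> nanowords \<alpha>" by (simp add: nanowords_def double_occurrence_def)
  ultimately have "metamorphosis \<alpha> \<tau> 0 ?v (fst ?v, [])" using v by (intro metamorphosis_surgery) auto
  moreover have "metamorphosis \<alpha> \<tau> 0 (fst ?v, []) empty_nanoword"
    using e empty_nanoword_in_nanowords isomorphic_empty by (intro metamorphosis_isomorphic) auto
  ultimately show ?thesis using metamorphosis_trans by (metis add_0)
qed


section \<open>The group of cobordism classes\<close>

text \<open>Arch counts are nonnegative, so a total of 0 forces every single move to have no arches,
  and its bridge moves are then surgeries. Equality of cobordism classes thus becomes a statement
  about the arch count.\<close>

lemma cobordism_iff_metamorphosis:
  "(v, w) \<in> cobordism \<alpha> \<tau> \<longleftrightarrow> metamorphosis \<alpha> \<tau> 0 v w"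
proof
  have s: "metamorphosis \<alpha> \<tau> 0 v w" if "(v, w) \<in> cobordism_step \<alpha> \<tau>" for v w
    using that metamorphosis_elementary(1)[of \<alpha> \<tau> 0 v w] metamorphosis_surgery[of v \<alpha> w \<tau>]
    by (auto simp: cobordism_step_def elementary_move_def)
  assume "(v, w) \<in> cobordism \<alpha> \<tau>"
  then have "(v, w) \<in> (cobordism_step \<alpha> \<tau> \<union> (cobordism_step \<alpha> \<tau>)\<inverse>)\<^sup>*" and v: "v \<in> nanowords \<alpha>"
    by (auto simp: cobordism_def)
  then show "metamorphosis \<alpha> \<tau> 0 v w"
  proof (induction rule: rtrancl_induct)
    case base
    then show ?case by (rule metamorphosis.refl)
  next
    case (step y z)
    then have "metamorphosis \<alpha> \<tau> 0 y z" using s metamorphosis_sym by blast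
    with step show ?case using metamorphosis_trans by (metis add_0)
  qed
next
  assume m: "metamorphosis \<alpha> \<tau> 0 v w"
  \<comment> \<open>The count is kept as a variable so that the induction can split it into the
    first move and the rest.\<close>
  have "n = 0 \<Longrightarrow> (v, w) \<in> (cobordism_step \<alpha> \<tau> \<union> (cobordism_step \<alpha> \<tau>)\<inverse>)\<^sup>*"
    if "metamorphosis \<alpha> \<tau> n v w" for n
    using that
  proof (induction rule: metamorphosis.induct)
    case (step g u v n w)
    then have "(u, v) \<in> cobordism_step \<alpha> \<tau> \<union> (cobordism_step \<alpha> \<tau>)\<inverse>"
      using bridge_move_zero_imp_surgery by (fastforce simp: elementary_move_def cobordism_step_def)
    with step show ?case by (simp add: converse_rtrancl_into_rtrancl)
  qed simp
  then show "(v, w) \<in> cobordism \<alpha> \<tau>"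
    using m metamorphosis_in_nanowords[OF m] by (simp add: cobordism_def)
qed

lemma equiv_cobordism: "equiv (nanowords \<alpha>) (cobordism \<alpha> \<tau>)"
proof (rule equivI)
  show "cobordism \<alpha> \<tau> \<subseteq> nanowords \<alpha> \<times> nanowords \<alpha>" by (simp add: cobordism_def)
  show "refl_on (nanowords \<alpha>) (cobordism \<alpha> \<tau>)"
    by (auto simp: refl_on_def cobordism_iff_metamorphosis intro: metamorphosis.refl)
  show "sym (cobordism \<alpha> \<tau>)"
    by (auto simp: sym_def cobordism_iff_metamorphosis intro: metamorphosis_sym)
  show "trans (cobordism \<alpha> \<tau>)"
    by (auto simp: trans_def cobordism_iff_metamorphosis dest: metamorphosis_trans)
qed

lemma cobordism_class_eq_iff:
  "v \<in> nanowords \<alpha> \<Longrightarrow> w \<in> nanowords \<alpha> \<Longrightarrow>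
    cobordism_class \<alpha> \<tau> v = cobordism_class \<alpha> \<tau> w \<longleftrightarrow> metamorphosis \<alpha> \<tau> 0 v w"
  unfolding cobordism_class_def
  using eq_equiv_class_iff[OF equiv_cobordism] cobordism_iff_metamorphosis by blast

lemma mem_cobordism_class_iff: "v \<in> cobordism_class \<alpha> \<tau> w \<longleftrightarrow> metamorphosis \<alpha> \<tau> 0 w v"
  by (simp add: cobordism_class_def cobordism_iff_metamorphosis)

lemma carrier_cobordism_group:
  "carrier (cobordism_group \<alpha> \<tau>) = cobordism_class \<alpha> \<tau> ` nanowords \<alpha>"
  by (auto simp: cobordism_group_def quotient_def cobordism_class_def)

lemma one_cobordism_group: "\<one>\<^bsub>cobordism_group \<alpha> \<tau>\<^esub> = cobordism_class \<alpha> \<tau> empty_nanoword"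
  by (simp add: cobordism_group_def)

text \<open>The product is a union over all representatives. Cobordant factors have cobordant
  products, so all members of the union coincide, and the union is over nonempty classes.\<close>

lemma mult_cobordism_group:
  assumes "v \<in> nanowords \<alpha>" and "w \<in> nanowords \<alpha>"
  shows "cobordism_class \<alpha> \<tau> v \<otimes>\<^bsub>cobordism_group \<alpha> \<tau>\<^esub> cobordism_class \<alpha> \<tau> w =
    cobordism_class \<alpha> \<tau> (nanoword_prod v w)"
proof -
  have c: "cobordism_class \<alpha> \<tau> (nanoword_prod v' w') = cobordism_class \<alpha> \<tau> (nanoword_prod v w)"
    if "v' \<in> cobordism_class \<alpha> \<tau> v" "w' \<in> cobordism_class \<alpha> \<tau> w" for v' w'
  proof -
    have "metamorphosis \<alpha> \<tau> 0 (nanoword_prod v w) (nanoword_prod v' w')"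
      using that metamorphosis_nanoword_prod by (metis add_0 mem_cobordism_class_iff)
    then show ?thesis
      using cobordism_class_eq_iff metamorphosis_in_nanowords by metis
  qed
  have "v \<in> cobordism_class \<alpha> \<tau> v" "w \<in> cobordism_class \<alpha> \<tau> w"
    using assms by (auto simp: mem_cobordism_class_iff intro: metamorphosis.refl)
  then have "cobordism_class \<alpha> \<tau> v \<noteq> {}" "cobordism_class \<alpha> \<tau> w \<noteq> {}" by blast+
  then show ?thesis by (simp add: cobordism_group_def c cong: SUP_cong)
qed

lemma cobordism_class_isomorphic:
  "v \<in> nanowords \<alpha> \<Longrightarrow> w \<in> nanowords \<alpha> \<Longrightarrow> isomorphic v w \<Longrightarrow>
    cobordism_class \<alpha> \<tau> v = cobordism_class \<alpha> \<tau> w"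
  by (simp add: cobordism_class_eq_iff metamorphosis_isomorphic)

lemma opposite_mult_cobordism_group:
  assumes "w \<in> nanowords \<alpha>"
  shows "cobordism_class \<alpha> \<tau> (opposite w) \<otimes>\<^bsub>cobordism_group \<alpha> \<tau>\<^esub> cobordism_class \<alpha> \<tau> w =
    \<one>\<^bsub>cobordism_group \<alpha> \<tau>\<^esub>"
  using assms metamorphosis_opposite_prod[OF assms, of \<tau>]
  by (simp add: mult_cobordism_group one_cobordism_group cobordism_class_eq_iff
      opposite_in_nanowords nanoword_prod_in_nanowords empty_nanoword_in_nanowords)

text \<open>A left unit and left inverses suffice; the latter come from the cobordism of
  \<open>w\<^sup>- w\<close> to the empty nanoword.\<close>

lemma group_cobordism_group: "group (cobordism_group \<alpha> \<tau>)"
proof (rule groupI)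
  show "\<one>\<^bsub>cobordism_group \<alpha> \<tau>\<^esub> \<in> carrier (cobordism_group \<alpha> \<tau>)"
    by (simp add: one_cobordism_group carrier_cobordism_group empty_nanoword_in_nanowords)
next
  fix X Y assume "X \<in> carrier (cobordism_group \<alpha> \<tau>)" "Y \<in> carrier (cobordism_group \<alpha> \<tau>)"
  then show "X \<otimes>\<^bsub>cobordism_group \<alpha> \<tau>\<^esub> Y \<in> carrier (cobordism_group \<alpha> \<tau>)"
    by (auto simp: carrier_cobordism_group mult_cobordism_group nanoword_prod_in_nanowords)
next
  fix X Y Z
  assume "X \<in> carrier (cobordism_group \<alpha> \<tau>)" "Y \<in> carrier (cobordism_group \<alpha> \<tau>)"
    "Z \<in> carrier (cobordism_group \<alpha> \<tau>)"
  then show "X \<otimes>\<^bsub>cobordism_group \<alpha> \<tau>\<^esub> Y \<otimes>\<^bsub>cobordism_group \<alpha> \<tau>\<^esub> Z =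
      X \<otimes>\<^bsub>cobordism_group \<alpha> \<tau>\<^esub> (Y \<otimes>\<^bsub>cobordism_group \<alpha> \<tau>\<^esub> Z)"
    by (auto simp: carrier_cobordism_group mult_cobordism_group nanoword_prod_in_nanowords
        cobordism_class_isomorphic[OF _ _ isomorphic_nanoword_prod_assoc])
next
  fix X assume "X \<in> carrier (cobordism_group \<alpha> \<tau>)"
  then show "\<one>\<^bsub>cobordism_group \<alpha> \<tau>\<^esub> \<otimes>\<^bsub>cobordism_group \<alpha> \<tau>\<^esub> X = X"
    by (auto simp: carrier_cobordism_group one_cobordism_group mult_cobordism_group
        nanoword_prod_in_nanowords empty_nanoword_in_nanowords
        cobordism_class_isomorphic[OF _ _ isomorphic_nanoword_prod_empty_left])
next
  fix X assume "X \<in> carrier (cobordism_group \<alpha> \<tau>)"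
  then show "\<exists>Y\<in>carrier (cobordism_group \<alpha> \<tau>). Y \<otimes>\<^bsub>cobordism_group \<alpha> \<tau>\<^esub> X = \<one>\<^bsub>cobordism_group \<alpha> \<tau>\<^esub>"
    using opposite_mult_cobordism_group opposite_in_nanowords by (fastforce simp: carrier_cobordism_group)
qed

lemma inv_cobordism_group:
  assumes "w \<in> nanowords \<alpha>"
  shows "inv\<^bsub>cobordism_group \<alpha> \<tau>\<^esub> cobordism_class \<alpha> \<tau> w = cobordism_class \<alpha> \<tau> (opposite w)"
  using assms
  by (intro group.inv_equality group_cobordism_group opposite_mult_cobordism_group)
    (auto simp: carrier_cobordism_group opposite_in_nanowords)


section \<open>The bridge norm\<close>

lemma bridge_norm_le: "metamorphosis \<alpha> \<tau> n w empty_nanoword \<Longrightarrow> bridge_norm \<alpha> \<tau> w \<le> n"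
  unfolding bridge_norm_def by (rule Least_le)

text \<open>Used with \<open>n = 0\<close> in both directions, this makes the bridge norm constant
  on cobordism classes.\<close>

lemma bridge_norm_le_metamorphosis:
  assumes "metamorphosis \<alpha> \<tau> n v w"
  shows "bridge_norm \<alpha> \<tau> v \<le> n + bridge_norm \<alpha> \<tau> w"
  using assms metamorphosis_in_nanowords bridge_norm_attained metamorphosis_trans bridge_norm_le
  by metis

text \<open>Because the minimum is attained, norm 0 yields an actual metamorphosis without arches,
  that is, a cobordism to the empty nanoword.\<close>

lemma bridge_norm_eq_zero_iff:
  assumes "w \<in> nanowords \<alpha>"
  shows "bridge_norm \<alpha> \<tau> w = 0 \<longleftrightarrow> metamorphosis \<alpha> \<tau> 0 w empty_nanoword"
  using bridge_norm_attained[OF assms, of \<tau>] bridge_norm_le by fastforce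

lemma bridge_norm_nanoword_prod_le:
  assumes "v \<in> nanowords \<alpha>" and "w \<in> nanowords \<alpha>"
  shows "bridge_norm \<alpha> \<tau> (nanoword_prod v w) \<le> bridge_norm \<alpha> \<tau> v + bridge_norm \<alpha> \<tau> w"
proof -
  have "metamorphosis \<alpha> \<tau> (bridge_norm \<alpha> \<tau> v + bridge_norm \<alpha> \<tau> w)
      (nanoword_prod v w) (nanoword_prod empty_nanoword empty_nanoword)"
    using assms by (intro metamorphosis_nanoword_prod bridge_norm_attained)
  moreover have "metamorphosis \<alpha> \<tau> 0 (nanoword_prod empty_nanoword empty_nanoword) empty_nanoword"
    by (intro metamorphosis_isomorphic isomorphic_nanoword_prod_empty_left
        nanoword_prod_in_nanowords empty_nanoword_in_nanowords)
  ultimately show ?thesis using metamorphosis_trans bridge_norm_le by (metis add_0_right)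
qed

text \<open>Multiplying a metamorphosis \<open>w \<rightarrow> \<emptyset>\<close> by \<open>w\<^sup>-\<close> gives one from \<open>w\<^sup>- w\<close>, which is cobordant to \<open>\<emptyset>\<close>,
  to \<open>w\<^sup>-\<close>; so no move has to be reversed letter by letter.\<close>

lemma bridge_norm_opposite_le:
  assumes w: "w \<in> nanowords \<alpha>"
  shows "bridge_norm \<alpha> \<tau> (opposite w) \<le> bridge_norm \<alpha> \<tau> w"
proof -
  have o: "opposite w \<in> nanowords \<alpha>" using w by (rule opposite_in_nanowords)
  have 1: "metamorphosis \<alpha> \<tau> 0 (opposite w) (nanoword_prod (opposite w) empty_nanoword)"
    using o by (intro metamorphosis_sym[OF metamorphosis_isomorphic]
        isomorphic_nanoword_prod_empty_right nanoword_prod_in_nanowords empty_nanoword_in_nanowords)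
  have 2: "metamorphosis \<alpha> \<tau> (bridge_norm \<alpha> \<tau> w)
      (nanoword_prod (opposite w) empty_nanoword) (nanoword_prod (opposite w) w)"
    using metamorphosis_sym[OF bridge_norm_attained[OF w]] o
    by (rule metamorphosis_nanoword_prod_left)
  show ?thesis
    using metamorphosis_trans[OF 1 metamorphosis_trans[OF 2 metamorphosis_opposite_prod[OF w]]]
      bridge_norm_le by fastforce
qed

text \<open>Destroying \<open>v\<close> inside the product costs its norm, and the remaining
  \<open>w\<^sup>- w\<close> vanishes without arches. Equality is obtained later, by conjugating
  back.\<close>

lemma bridge_norm_conj_le:
  assumes v: "v \<in> nanowords \<alpha>" and w: "w \<in> nanowords \<alpha>"
  shows "bridge_norm \<alpha> \<tau> (nanoword_prod (nanoword_prod (opposite w) v) w) \<le> bridge_norm \<alpha> \<tau> v"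
proof -
  have o: "opposite w \<in> nanowords \<alpha>" using w by (rule opposite_in_nanowords)
  have 1: "metamorphosis \<alpha> \<tau> (bridge_norm \<alpha> \<tau> v) (nanoword_prod (nanoword_prod (opposite w) v) w)
      (nanoword_prod (nanoword_prod (opposite w) empty_nanoword) w)"
    using v w o by (intro metamorphosis_nanoword_prod_left metamorphosis_nanoword_prod_right
        bridge_norm_attained)
  have 2: "metamorphosis \<alpha> \<tau> 0 (nanoword_prod (nanoword_prod (opposite w) empty_nanoword) w)
      (nanoword_prod (opposite w) w)"
    using w o by (intro metamorphosis_nanoword_prod_right metamorphosis_isomorphic
        isomorphic_nanoword_prod_empty_right nanoword_prod_in_nanowords empty_nanoword_in_nanowords)
  show ?thesis
    using metamorphosis_trans[OF 1 metamorphosis_trans[OF 2 metamorphosis_opposite_prod[OF w]]]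
      bridge_norm_le by fastforce
qed

theorem lemma9p3p1:
  fixes \<alpha> :: "'a set" and \<tau> :: "'a \<Rightarrow> 'a"
  assumes "\<tau> \<in> \<alpha> \<rightarrow> \<alpha>"
    and "\<And>a. a \<in> \<alpha> \<Longrightarrow> \<tau> (\<tau> a) = a"
  shows "\<exists>f. (\<forall>w\<in>nanowords \<alpha>. f (cobordism_class \<alpha> \<tau> w) = bridge_norm \<alpha> \<tau> w) \<and>
             conj_invariant_norm (cobordism_group \<alpha> \<tau>) f"
proof -
  let ?G = "cobordism_group \<alpha> \<tau>" and ?c = "cobordism_class \<alpha> \<tau>" and ?b = "bridge_norm \<alpha> \<tau>"
  interpret group ?G by (rule group_cobordism_group)
  \<comment> \<open>Any representative may be chosen, since cobordant nanowords have the same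
    norm.\<close>
  define f where "f X = ?b (SOME w. w \<in> X)" for X
  have f: "f (?c w) = ?b w" if w: "w \<in> nanowords \<alpha>" for w
  proof -
    have "w \<in> ?c w" using w by (simp add: mem_cobordism_class_iff metamorphosis.refl)
    then have "(SOME v. v \<in> ?c w) \<in> ?c w" by (rule someI)
    then have "metamorphosis \<alpha> \<tau> 0 w (SOME v. v \<in> ?c w)" by (simp add: mem_cobordism_class_iff)
    then show ?thesis
      unfolding f_def using bridge_norm_le_metamorphosis metamorphosis_sym
      by (metis add_0 le_antisym)
  qed
  \<comment> \<open>Inequalities are enough here: inversion and conjugation are undone by operations
    of the same kind, so a second application gives the reverse inequality.\<close>
  have inv_le: "f (inv\<^bsub>?G\<^esub> g) \<le> f g" if "g \<in> carrier ?G" for g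
    using that by (auto simp: carrier_cobordism_group inv_cobordism_group f opposite_in_nanowords
        bridge_norm_opposite_le)
  have conj_le: "f (inv\<^bsub>?G\<^esub> h \<otimes>\<^bsub>?G\<^esub> g \<otimes>\<^bsub>?G\<^esub> h) \<le> f g" if "g \<in> carrier ?G" "h \<in> carrier ?G" for g h
    using that by (auto simp: carrier_cobordism_group inv_cobordism_group mult_cobordism_group f
        opposite_in_nanowords nanoword_prod_in_nanowords bridge_norm_conj_le)
  have "conj_invariant_norm ?G f"
    unfolding conj_invariant_norm_def
  proof (intro conjI ballI)
    show "group ?G" by (rule group_cobordism_group)
  next
    fix g assume "g \<in> carrier ?G"
    then obtain w where "w \<in> nanowords \<alpha>" "g = ?c w" by (auto simp: carrier_cobordism_group)
    then show "f g = 0 \<longleftrightarrow> g = \<one>\<^bsub>?G\<^esub>"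
      by (simp add: one_cobordism_group f bridge_norm_eq_zero_iff cobordism_class_eq_iff
          empty_nanoword_in_nanowords)
  next
    fix g assume g: "g \<in> carrier ?G"
    then show "f (inv\<^bsub>?G\<^esub> g) = f g"
      using inv_le[OF g] inv_le[of "inv\<^bsub>?G\<^esub> g"] by simp
  next
    fix g h assume "g \<in> carrier ?G" "h \<in> carrier ?G"
    then show "f (g \<otimes>\<^bsub>?G\<^esub> h) \<le> f g + f h"
      by (auto simp: carrier_cobordism_group mult_cobordism_group f nanoword_prod_in_nanowords
          bridge_norm_nanoword_prod_le)
  next
    fix g h assume g: "g \<in> carrier ?G" and h: "h \<in> carrier ?G"
    let ?k = "inv\<^bsub>?G\<^esub> h \<otimes>\<^bsub>?G\<^esub> g \<otimes>\<^bsub>?G\<^esub> h"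
    \<comment> \<open>Conjugating \<open>?k\<close> by the inverse of \<open>h\<close> recovers
      \<open>g\<close>, so \<open>conj_le\<close> also bounds \<open>f g\<close> by
      \<open>f ?k\<close>.\<close>
    have "inv\<^bsub>?G\<^esub> (inv\<^bsub>?G\<^esub> h) \<otimes>\<^bsub>?G\<^esub> ?k \<otimes>\<^bsub>?G\<^esub> inv\<^bsub>?G\<^esub> h = g"
      using g h by (simp add: m_assoc) (simp add: m_assoc[symmetric])
    then show "f ?k = f g"
      using conj_le[OF g h] conj_le[of ?k "inv\<^bsub>?G\<^esub> h"] g h by simp
  qed
  with f show ?thesis by blast
qed

end
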